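(* Let $\mathbb{M}$ be a local Moufang set, with fixed non-equivalent points $0,\infty\in X$, such that (R1) $\mathbb{M}$ is special; (R2) the root group $U_\infty$ is abelian; (R3) the Hua subgroup $H$ is abelian; (R4) if $x$ is a unit, then $x\cdot 2$ is a unit. Fix a unit $e$, and let $R=X\setminus\overline{\infty}$ be equipped with the addition and multiplication defined in the context. Then $R$ is a (commutative, unital) local ring, and $2$ is invertible in $R$.
   Context: Conventions: all actions are on the right, $xg$ (or $x\cdot g$) is the image of $x$ under $g$, products are composed left to right, $g^h=h^{-1}gh$. For a set with an equivalence relation $(X,\sim)$, $\overline{x}$ is the class of $x$, $\overline{X}$ is the set of classes, and $\mathrm{Sym}(X,\sim)$ is the group of permutations of $X$ preserving the equivalence relation. Local rings are commutative with $1$. A local Moufang set consists of $(X,\sim)$ with $|\overline{X}|>2$ and subgroups $U_x\le\mathrm{Sym}(X,\sim)$ for $x\in X$ (root groups). Write $U_{\overline{x}}$ for the image of $U_x$ in $\mathrm{Sym}(\overline{X})$ and $G=\langle U_x\mid x\in X\rangle$. The axioms are: (LM1) if $x\sim y$ then $U_{\overline{x}}=U_{\overline{y}}$; (LM2) for $x\in X$, $U_x$ fixes $x$ and acts sharply transitively on $X\setminus\overline{x}$; (LM2') for $\overline{x}\in\overline{X}$, $U_{\overline{x}}$ fixes $\overline{x}$ and acts sharply transitively on $\overline{X}\setminus\{\overline{x}\}$; (LM3) $U_x^g=U_{xg}$ for all $x\in X$, $g\in G$. Fix $0,\infty\in X$ with $0\nsim\infty$. For $x\nsim\infty$, $\alpha_x$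 is the unique element of $U_\infty$ mapping $0$ to $x$, $-x:=0\alpha_x^{-1}$ (so $\alpha_{-x}=\alpha_x^{-1}$), and $x\cdot 2:=0\alpha_x^2$. A unit is an $x\in X$ with $x\nsim0$, $x\nsim\infty$. For a unit $x$, $\mu_x$ is the unique element of the double coset $U_0\alpha_xU_0$ interchanging $0$ and $\infty$ (it exists and is unique); such elements are called $\mu$-maps. The Hua subgroup is $H=\langle\mu_x\mu_y\mid x,y\text{ units}\rangle$. $\mathbb{M}$ is special if $(-x)\tau=-(x\tau)$ for all units $x$, where $\tau$ is a $\mu$-map (the condition does not depend on which $\mu$-map is used). Ring construction (under (R1)--(R4)): put $R:=X\setminus\overline{\infty}$ and $x+y:=0\cdot\alpha_x\alpha_y$ for $x,y\in R$; then $(R,+)$ is an abelian group with neutral element $0$, negation $x\mapsto -x$, and it is uniquely $2$-divisible (write $z/2$ for the unique $w$ with $w+w=z$). Fix a unit $e$ and set $h_x:=\mu_e\mu_x$ for units $x$. With $2e=e+e$, for $y\in R$ define $R_y:R\to R$ by $xR_y:=x h_{e+y}-x h_y-x$ if $y$ and $y+e$ are units; $xR_y:=-x h_{-e+y}+x+x h_y$ if $y$ is a unit and $y+e$ is not a unit; $xR_y:=x h_{2e+y}-x h_{e+y}-x h_{-2e}+x$ if $y$ is not a unit (all Hua maps occurring here are indexed by units). The multiplication is $xy:=(xR_y)/2$ for $x,y\in R$. *)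

theory Defs
  imports "HOL-Combinatorics.Permutations" "HOL-Algebra.Generated_Groups" "HOL-Algebra.Ideal"
begin

(* Actions are on the right in the mathematics: the image xg is written g x here, and the
   product of the group below composes left to right, so that (g \<otimes> h) x = h (g x).
   Permutations of X are functions that are the identity outside X. *)

definition sym_rel :: "'a set \<Rightarrow> ('a \<times> 'a) set \<Rightarrow> ('a \<Rightarrow> 'a) monoid" where
  "sym_rel X r =
     \<lparr> carrier = {g. g permutes X \<and> (\<forall>x\<in>X. \<forall>y\<in>X. (g x, g y) \<in> r \<longleftrightarrow> (x, y) \<in> r)},
       mult = (\<lambda>g h. h \<circ> g),
       one = id \<rparr>"

lemma group_sym_rel: "group (sym_rel X r)"
proof (rule groupI)
  fix g assume "g \<in> carrier (sym_rel X r)"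
  then have g: "g permutes X" "\<And>x y. x \<in> X \<Longrightarrow> y \<in> X \<Longrightarrow> (g x, g y) \<in> r \<longleftrightarrow> (x, y) \<in> r"
    by (auto simp: sym_rel_def)
  have "(inv_into UNIV g x, inv_into UNIV g y) \<in> r \<longleftrightarrow> (x, y) \<in> r" if "x \<in> X" "y \<in> X" for x y
    using g(2)[of "inv_into UNIV g x" "inv_into UNIV g y"] that g(1)
    by (simp add: permutes_inverses permutes_in_image[OF permutes_inv])
  then have "inv_into UNIV g \<in> carrier (sym_rel X r)"
    using g(1) by (simp add: sym_rel_def permutes_inv)
  moreover have "inv_into UNIV g \<otimes>\<^bsub>sym_rel X r\<^esub> g = \<one>\<^bsub>sym_rel X r\<^esub>"
    using g(1) by (simp add: sym_rel_def permutes_inv_o)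
  ultimately show "\<exists>h\<in>carrier (sym_rel X r). h \<otimes>\<^bsub>sym_rel X r\<^esub> g = \<one>\<^bsub>sym_rel X r\<^esub>" by blast
qed (auto simp: sym_rel_def permutes_compose permutes_id permutes_in_image o_assoc)

definition induced :: "'a set \<Rightarrow> ('a \<times> 'a) set \<Rightarrow> ('a \<Rightarrow> 'a) \<Rightarrow> 'a set \<Rightarrow> 'a set" where
  "induced X r g C = (if C \<in> X // r then g ` C else C)"

definition sharply_transitive_on :: "('b \<Rightarrow> 'b) set \<Rightarrow> 'b set \<Rightarrow> bool" where
  "sharply_transitive_on V A \<longleftrightarrow>
     (\<forall>g\<in>V. g ` A = A) \<and> (\<forall>a\<in>A. \<forall>b\<in>A. \<exists>!g. g \<in> V \<and> g a = b)"

locale local_moufang_set =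
  fixes X :: "'a set" and r :: "('a \<times> 'a) set" and U :: "'a \<Rightarrow> ('a \<Rightarrow> 'a) set"
  assumes equiv: "equiv X r"
    (* the number of classes may be infinite, where card would be 0 *)
    and classes: "infinite (X // r) \<or> card (X // r) > 2"
    and root_subgroup: "x \<in> X \<Longrightarrow> subgroup (U x) (sym_rel X r)"
    and LM1: "(x, y) \<in> r \<Longrightarrow> induced X r ` U x = induced X r ` U y"
    and LM2_fix: "x \<in> X \<Longrightarrow> g \<in> U x \<Longrightarrow> g x = x"
    and LM2_trans: "x \<in> X \<Longrightarrow> sharply_transitive_on (U x) (X - r `` {x})"
    and LM2'_fix: "x \<in> X \<Longrightarrow> \<gamma> \<in> induced X r ` U x \<Longrightarrow> \<gamma> (r `` {x}) = r `` {x}"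
    and LM2'_trans: "x \<in> X \<Longrightarrow>
           sharply_transitive_on (induced X r ` U x) (X // r - {r `` {x}})"
    and LM3: "x \<in> X \<Longrightarrow> g \<in> generate (sym_rel X r) (\<Union>y\<in>X. U y) \<Longrightarrow>
           (\<lambda>u. inv\<^bsub>sym_rel X r\<^esub> g \<otimes>\<^bsub>sym_rel X r\<^esub> u \<otimes>\<^bsub>sym_rel X r\<^esub> g) ` U x = U (g x)"

locale pointed_local_moufang_set = local_moufang_set X r U
  for X :: "'a set" and r :: "('a \<times> 'a) set" and U :: "'a \<Rightarrow> ('a \<Rightarrow> 'a) set" +
  fixes orig infty :: 'a
  assumes orig_in: "orig \<in> X" and infty_in: "infty \<in> X"
    and not_equiv: "(orig, infty) \<notin> r"
begin

abbreviation S :: "('a \<Rightarrow> 'a) monoid" where "S \<equiv> sym_rel X r"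

definition R :: "'a set" where "R = X - r `` {infty}"

definition units :: "'a set" where "units = {x \<in> X. (x, orig) \<notin> r \<and> (x, infty) \<notin> r}"

definition \<alpha> :: "'a \<Rightarrow> 'a \<Rightarrow> 'a" where
  "\<alpha> x = (THE g. g \<in> U infty \<and> g orig = x)"

definition neg :: "'a \<Rightarrow> 'a" where "neg x = (inv\<^bsub>S\<^esub> (\<alpha> x)) orig"

definition twice :: "'a \<Rightarrow> 'a" where "twice x = (\<alpha> x \<otimes>\<^bsub>S\<^esub> \<alpha> x) orig"

definition \<mu> :: "'a \<Rightarrow> 'a \<Rightarrow> 'a" where
  "\<mu> x = (THE g. g \<in> {a \<otimes>\<^bsub>S\<^esub> \<alpha> x \<otimes>\<^bsub>S\<^esub> b | a b. a \<in> U orig \<and> b \<in> U orig} \<and>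
                g orig = infty \<and> g infty = orig)"

definition hua_subgroup :: "('a \<Rightarrow> 'a) set" where
  "hua_subgroup = generate S {\<mu> x \<otimes>\<^bsub>S\<^esub> \<mu> y | x y. x \<in> units \<and> y \<in> units}"

(* The condition is the same for all \<mu>-maps \<tau>; units is never empty, as there are more
   than two classes. *)
definition special :: bool where
  "special \<longleftrightarrow> (\<exists>\<tau>\<in>\<mu> ` units. \<forall>x\<in>units. \<tau> (neg x) = neg (\<tau> x))"

definition padd :: "'a \<Rightarrow> 'a \<Rightarrow> 'a" (infixl "\<boxplus>" 65) where
  "x \<boxplus> y = (\<alpha> x \<otimes>\<^bsub>S\<^esub> \<alpha> y) orig"

abbreviation psub :: "'a \<Rightarrow> 'a \<Rightarrow> 'a" (infixl "\<boxminus>" 65) where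
  "x \<boxminus> y \<equiv> x \<boxplus> neg y"

definition half :: "'a \<Rightarrow> 'a" where "half z = (THE w. w \<in> R \<and> w \<boxplus> w = z)"

definition hua :: "'a \<Rightarrow> 'a \<Rightarrow> 'a \<Rightarrow> 'a" where "hua e x = \<mu> e \<otimes>\<^bsub>S\<^esub> \<mu> x"

(* rmul e y x is the element x R_y; twice the eventual product x y *)
definition rmul :: "'a \<Rightarrow> 'a \<Rightarrow> 'a \<Rightarrow> 'a" where
  "rmul e y x =
     (if y \<in> units \<and> y \<boxplus> e \<in> units then
        hua e (e \<boxplus> y) x \<boxminus> hua e y x \<boxminus> x
      else if y \<in> units then
        neg (hua e (neg e \<boxplus> y) x) \<boxplus> x \<boxplus> hua e y x
      else
        hua e ((e \<boxplus> e) \<boxplus> y) x \<boxminus> hua e (e \<boxplus> y) x \<boxminus> hua e (neg (e \<boxplus> e)) x \<boxplus> x)"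

definition pmul :: "'a \<Rightarrow> 'a \<Rightarrow> 'a \<Rightarrow> 'a" where "pmul e x y = half (rmul e y x)"

definition hua_ring :: "'a \<Rightarrow> 'a \<Rightarrow> 'a ring" where
  "hua_ring e u = \<lparr> carrier = R, mult = pmul e, one = u, zero = orig, add = padd \<rparr>"

end

definition local_ring :: "('a, 'b) ring_scheme \<Rightarrow> bool" where
  "local_ring A \<longleftrightarrow> cring A \<and> (\<exists>!I. maximalideal I A)"

end

theory Submission
  imports Defs
begin

text \<open>
  Write \<open>s\<^sub>y = e h\<^sub>y\<close>. Specialness turns \<open>\<mu>\<^sub>x\<close> into a product
  \<open>\<alpha>\<^sub>x \<cdot> \<mu>\<^sub>e\<^sup>-\<^sup>1 \<alpha>\<^sub>v \<mu>\<^sub>e \<cdot> \<alpha>\<^sub>x\<close> with \<open>v = - x \<mu>\<^sub>e\<^sup>-\<^sup>1\<close>, and comparing two such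
  products yields \<open>(-t) \<mu>\<^sub>t\<^sub>+\<^sub>y = (-t) \<mu>\<^sub>y + 2y + t\<close> whenever \<open>t\<close>, \<open>y\<close>, \<open>t + y\<close> are units. The
  case \<open>t = e\<close> gives \<open>e R\<^sub>y = 2y\<close>. As the Hua maps are additive and commute, so do the \<open>R\<^sub>y\<close>, and
  \<open>2 (y R\<^sub>z) = e R\<^sub>y R\<^sub>z = e R\<^sub>z R\<^sub>y = 2 (z R\<^sub>y)\<close>; this makes the product commutative, and then
  associative with identity \<open>e\<close>.

  A Hua map \<open>h\<^sub>z\<close> commutes with all \<open>R\<^sub>x\<close>, so it is multiplication by the invertible element \<open>s\<^sub>z\<close>.
  The identity for arbitrary \<open>t\<close> implies \<open>y\<^sup>2 = s\<^sub>y\<close> if \<open>y\<close> and \<open>y + e\<close> are units, and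
  \<open>y\<^sup>2 = s\<^sub>-\<^sub>y\<close> holds otherwise; hence units are invertible and multiplication by \<open>y\<^sup>2\<close> preserves
  the set of non-units. By \<open>4xy = x(y + e)\<^sup>2 - x(y - e)\<^sup>2\<close> this set is an ideal.
\<close>

section \<open>Root groups and \<open>\<mu>\<close>-maps\<close>

context pointed_local_moufang_set
begin

abbreviation ginv :: "('a \<Rightarrow> 'a) \<Rightarrow> 'a \<Rightarrow> 'a" where "ginv \<equiv> inv_into UNIV"

definition little_projective_group :: "('a \<Rightarrow> 'a) set"
  where "little_projective_group = generate S (\<Union>y\<in>X. U y)"

text \<open>The stabilizer of both base points in the group generated by the root groups. It
  contains all products of two \<mu>-maps, in particular the Hua maps, and (LM3) makes its elements
  additive on \<open>R\<close>.\<close>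

definition stab :: "('a \<Rightarrow> 'a) set"
  where "stab = {h \<in> little_projective_group. h orig = orig \<and> h infty = infty}"

lemma group_S: "group S"
  by (rule group_sym_rel)

lemma mult_S [simp]: "g \<otimes>\<^bsub>S\<^esub> h = h \<circ> g"
  by (simp add: sym_rel_def)

lemma one_S [simp]: "\<one>\<^bsub>S\<^esub> = id"
  by (simp add: sym_rel_def)

lemma permutes_S: "g \<in> carrier S \<Longrightarrow> g permutes X"
  by (simp add: sym_rel_def)

lemma rel_S: "g \<in> carrier S \<Longrightarrow> x \<in> X \<Longrightarrow> y \<in> X \<Longrightarrow> (g x, g y) \<in> r \<longleftrightarrow> (x, y) \<in> r"
  by (simp add: sym_rel_def)

lemma in_X_S: "g \<in> carrier S \<Longrightarrow> g x \<in> X \<longleftrightarrow> x \<in> X"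
  using permutes_S permutes_in_image by fastforce

lemma inv_S:
  assumes "g \<in> carrier S"
  shows "inv\<^bsub>S\<^esub> g = ginv g"
proof -
  have "inv\<^bsub>S\<^esub> g \<circ> g = id"
    using group.r_inv[OF group_S assms] by simp
  moreover have "g \<circ> inv\<^bsub>S\<^esub> g = id"
    using group.l_inv[OF group_S assms] by simp
  ultimately show ?thesis
    using inv_unique_comp by metis
qed

lemma inv_apply [simp]:
  assumes "g \<in> carrier S"
  shows "ginv g (g x) = x" "g (ginv g x) = x" "ginv g \<circ> g = id" "g \<circ> ginv g = id"
        "ginv (ginv g) = g"
  using permutes_S[OF assms] by (auto simp: permutes_inverses permutes_inv_o permutes_inv_inv)

lemma inv_eq_iff: "g \<in> carrier S \<Longrightarrow> ginv g x = y \<longleftrightarrow> x = g y"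
  by (metis inv_apply(1,2))

lemma root_S: "x \<in> X \<Longrightarrow> g \<in> U x \<Longrightarrow> g \<in> carrier S"
  using subgroup.subset[OF root_subgroup] by blast

lemma root_comp: "x \<in> X \<Longrightarrow> g \<in> U x \<Longrightarrow> h \<in> U x \<Longrightarrow> g \<circ> h \<in> U x"
  using subgroup.m_closed[OF root_subgroup, of x h g] by simp

lemma root_inv: "x \<in> X \<Longrightarrow> g \<in> U x \<Longrightarrow> ginv g \<in> U x"
  using subgroup.m_inv_closed[OF root_subgroup, of x g] inv_S root_S by metis

lemma root_id: "x \<in> X \<Longrightarrow> id \<in> U x"
  using subgroup.one_closed[OF root_subgroup, of x] by simp

lemma subgroup_G: "subgroup little_projective_group S"
  unfolding little_projective_group_def
  using root_S by (intro group.generate_is_subgroup[OF group_S]) auto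

lemma G_S: "g \<in> little_projective_group \<Longrightarrow> g \<in> carrier S"
  using subgroup.subset[OF subgroup_G] by blast

lemma G_comp:
  "g \<in> little_projective_group \<Longrightarrow> h \<in> little_projective_group \<Longrightarrow> g \<circ> h \<in> little_projective_group"
  using subgroup.m_closed[OF subgroup_G, of h g] by simp

lemma G_inv: "g \<in> little_projective_group \<Longrightarrow> ginv g \<in> little_projective_group"
  using subgroup.m_inv_closed[OF subgroup_G, of g] inv_S G_S by metis

lemma root_G: "x \<in> X \<Longrightarrow> g \<in> U x \<Longrightarrow> g \<in> little_projective_group"
  unfolding little_projective_group_def by (auto intro: generate.incl)

text \<open>(LM3) in terms of composition: the right-action conjugate of \<open>u\<close> by
  \<open>g\<close> becomes \<open>g \<circ> u \<circ> ginv g\<close>.\<close>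

lemma root_conj:
  assumes "x \<in> X" "g \<in> little_projective_group" "u \<in> U x"
  shows "g \<circ> u \<circ> ginv g \<in> U (g x)"
proof -
  have "inv\<^bsub>S\<^esub> g \<otimes>\<^bsub>S\<^esub> u \<otimes>\<^bsub>S\<^esub> g \<in> U (g x)"
    using LM3[OF assms(1), of g] assms unfolding little_projective_group_def by blast
  then show ?thesis
    by (simp add: inv_S[OF G_S[OF assms(2)]] o_assoc)
qed

lemma root_ex:
  assumes "x \<in> X" "a \<in> X" "b \<in> X" "(x, a) \<notin> r" "(x, b) \<notin> r"
  shows "\<exists>g\<in>U x. g a = b"
  using LM2_trans[OF assms(1)] assms unfolding sharply_transitive_on_def by blast

lemma root_unique:
  assumes "x \<in> X" "a \<in> X" "(x, a) \<notin> r" "g \<in> U x" "h \<in> U x" "g a = h a"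
  shows "g = h"
proof -
  have "g a \<in> X - r `` {x}"
    using LM2_trans[OF assms(1)] assms unfolding sharply_transitive_on_def by blast
  then show ?thesis
    using LM2_trans[OF assms(1)] assms unfolding sharply_transitive_on_def by blast
qed

lemma rel_sym: "(x, y) \<in> r \<Longrightarrow> (y, x) \<in> r"
  using equiv by (meson equivE symE)

lemma rel_trans: "(x, y) \<in> r \<Longrightarrow> (y, z) \<in> r \<Longrightarrow> (x, z) \<in> r"
  using equiv by (meson equivE transE)

lemma rel_refl: "x \<in> X \<Longrightarrow> (x, x) \<in> r"
  using equiv by (meson equivE refl_onD)

section \<open>The set \<open>R\<close>, its units and its addition\<close>

lemma R_iff: "x \<in> R \<longleftrightarrow> x \<in> X \<and> (infty, x) \<notin> r"
  by (auto simp: R_def)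

lemma orig_R: "orig \<in> R"
  using orig_in not_equiv rel_sym by (auto simp: R_iff)

lemma units_iff: "x \<in> units \<longleftrightarrow> x \<in> R \<and> (x, orig) \<notin> r"
  using rel_sym by (auto simp: units_def R_iff)

lemma units_R: "x \<in> units \<Longrightarrow> x \<in> R"
  by (simp add: units_iff)

lemma units_X: "x \<in> units \<Longrightarrow> x \<in> X"
  by (simp add: units_def)

lemma R_X: "x \<in> R \<Longrightarrow> x \<in> X"
  by (simp add: R_iff)

lemma root_infty_R: "g \<in> U infty \<Longrightarrow> x \<in> R \<Longrightarrow> g x \<in> R"
  using rel_S[OF root_S[OF infty_in], of g infty x] LM2_fix[OF infty_in, of g]
    in_X_S[OF root_S[OF infty_in], of g x] infty_in
  by (auto simp: R_iff)

lemma alpha_ex1: "x \<in> R \<Longrightarrow> \<exists>!g. g \<in> U infty \<and> g orig = x"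
  using root_ex[OF infty_in orig_in, of x] root_unique[OF infty_in orig_in] orig_R
  by (auto simp: R_iff)

lemma alpha_root: "x \<in> R \<Longrightarrow> \<alpha> x \<in> U infty"
  and alpha_orig: "x \<in> R \<Longrightarrow> \<alpha> x orig = x"
  using theI'[OF alpha_ex1, of x] unfolding \<alpha>_def by blast+

lemma alpha_S: "x \<in> R \<Longrightarrow> \<alpha> x \<in> carrier S"
  using alpha_root root_S infty_in by blast

lemma alpha_infty: "x \<in> R \<Longrightarrow> \<alpha> x infty = infty"
  using LM2_fix[OF infty_in] alpha_root by blast

lemma alpha_eqI: "g \<in> U infty \<Longrightarrow> g orig = x \<Longrightarrow> \<alpha> x = g"
  using alpha_ex1[of x] root_infty_R[OF _ orig_R] alpha_root alpha_orig by blast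

lemma alpha_zero: "\<alpha> orig = id"
  by (rule alpha_eqI) (auto simp: root_id infty_in)

lemma padd_eq: "x \<in> R \<Longrightarrow> x \<boxplus> y = \<alpha> y x"
  by (simp add: padd_def alpha_orig)

lemma padd_closed: "x \<in> R \<Longrightarrow> y \<in> R \<Longrightarrow> x \<boxplus> y \<in> R"
  by (simp add: padd_eq root_infty_R alpha_root)

text \<open>The addition is the group law of \<open>U infty\<close> carried over to \<open>R\<close>
  by \<open>\<alpha>\<close>.\<close>

lemma alpha_padd: "x \<in> R \<Longrightarrow> y \<in> R \<Longrightarrow> \<alpha> (x \<boxplus> y) = \<alpha> y \<circ> \<alpha> x"
  by (rule alpha_eqI) (auto simp: padd_def root_comp infty_in alpha_root)

lemma padd_assoc: "x \<in> R \<Longrightarrow> y \<in> R \<Longrightarrow> z \<in> R \<Longrightarrow> x \<boxplus> y \<boxplus> z = x \<boxplus> (y \<boxplus> z)"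
  by (simp add: padd_eq[of x "y \<boxplus> z"] alpha_padd) (simp add: padd_eq root_infty_R alpha_root)

lemma neg_eq: "x \<in> R \<Longrightarrow> neg x = ginv (\<alpha> x) orig"
  by (simp add: neg_def inv_S alpha_S)

lemma neg_R: "x \<in> R \<Longrightarrow> neg x \<in> R"
  by (simp add: neg_eq root_infty_R root_inv infty_in alpha_root orig_R)

lemma alpha_neg: "x \<in> R \<Longrightarrow> \<alpha> (neg x) = ginv (\<alpha> x)"
  by (rule alpha_eqI) (auto simp: neg_eq root_inv infty_in alpha_root)

lemma alpha_of_neg: "x \<in> R \<Longrightarrow> \<alpha> x (neg x) = orig"
  by (simp add: neg_eq alpha_S)

text \<open>\<open>\<alpha> x\<close> preserves the equivalence and sends \<open>neg x\<close> to
  \<open>orig\<close> and \<open>orig\<close> to \<open>x\<close>.\<close>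

lemma neg_units: "x \<in> units \<Longrightarrow> neg x \<in> units"
  using rel_S[of "\<alpha> x" "neg x" orig] rel_sym orig_in
  by (auto simp: units_iff neg_R alpha_S alpha_of_neg alpha_orig R_X)

lemma padd_neg: "x \<in> R \<Longrightarrow> neg x \<boxplus> x = orig"
  by (simp add: padd_eq neg_R alpha_of_neg)

text \<open>Both factors from \<open>U orig\<close> are forced: to interchange the base points, the
  first must send \<open>infty\<close> to \<open>neg x\<close> and the last must send
  \<open>x\<close> to \<open>infty\<close>. Sharp transitivity of \<open>U orig\<close> supplies
  exactly one of each.\<close>

lemma mu_ex1:
  assumes "x \<in> units"
  shows "\<exists>!g. g \<in> {a \<otimes>\<^bsub>S\<^esub> \<alpha> x \<otimes>\<^bsub>S\<^esub> b | a b. a \<in> U orig \<and> b \<in> U orig} \<and>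
                g orig = infty \<and> g infty = orig"
proof (rule ex_ex1I)
  have nx: "neg x \<in> units" by (rule neg_units[OF assms])
  note xR = units_R[OF assms]
  obtain a where a: "a \<in> U orig" "a infty = neg x"
    using root_ex[OF orig_in infty_in units_X[OF nx]] not_equiv nx rel_sym
    by (auto simp: units_iff)
  obtain b where b: "b \<in> U orig" "b x = infty"
    using root_ex[OF orig_in units_X[OF assms] infty_in] not_equiv assms rel_sym
    by (auto simp: units_iff)
  have "(b \<circ> (\<alpha> x \<circ> a)) orig = infty" "(b \<circ> (\<alpha> x \<circ> a)) infty = orig"
    using LM2_fix[OF orig_in a(1)] LM2_fix[OF orig_in b(1)] a(2) b(2) xR
    by (simp_all add: alpha_orig alpha_of_neg)
  then show "\<exists>g. g \<in> {a \<otimes>\<^bsub>S\<^esub> \<alpha> x \<otimes>\<^bsub>S\<^esub> b | a b. a \<in> U orig \<and> b \<in> U orig} \<and>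
                g orig = infty \<and> g infty = orig"
    using a b by fastforce
next
  fix g g'
  have *: "\<exists>a b. g = b \<circ> \<alpha> x \<circ> a \<and> a \<in> U orig \<and> b \<in> U orig \<and> a infty = neg x \<and> b x = infty"
    if "g \<in> {a \<otimes>\<^bsub>S\<^esub> \<alpha> x \<otimes>\<^bsub>S\<^esub> b | a b. a \<in> U orig \<and> b \<in> U orig} \<and>
                g orig = infty \<and> g infty = orig" for g
  proof -
    from that obtain a b
      where "g = a \<otimes>\<^bsub>S\<^esub> \<alpha> x \<otimes>\<^bsub>S\<^esub> b" "a \<in> U orig" "b \<in> U orig"
      by blast
    then have ab: "g = b \<circ> \<alpha> x \<circ> a" "a \<in> U orig" "b \<in> U orig"
      by (simp_all add: o_assoc)
    have g: "g orig = infty" "g infty = orig"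
      using that by blast+
    have "b x = infty"
      using g(1) ab(1) LM2_fix[OF orig_in ab(2)] units_R[OF assms] by (simp add: alpha_orig)
    moreover have "b (\<alpha> x (a infty)) = b orig"
      using g(2) ab(1) LM2_fix[OF orig_in ab(3)] by simp
    then have "\<alpha> x (a infty) = orig"
      using inv_apply(1)[OF root_S[OF orig_in ab(3)]] by metis
    then have "a infty = neg x"
      using inv_apply(1)[OF alpha_S[OF units_R[OF assms]]] neg_eq[OF units_R[OF assms]] by metis
    ultimately show ?thesis using ab by blast
  qed
  assume g: "g \<in> {a \<otimes>\<^bsub>S\<^esub> \<alpha> x \<otimes>\<^bsub>S\<^esub> b | a b. a \<in> U orig \<and> b \<in> U orig} \<and>
                g orig = infty \<and> g infty = orig"
     and g': "g' \<in> {a \<otimes>\<^bsub>S\<^esub> \<alpha> x \<otimes>\<^bsub>S\<^esub> b | a b. a \<in> U orig \<and> b \<in> U orig} \<and>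
                g' orig = infty \<and> g' infty = orig"
  obtain a b where ab: "g = b \<circ> \<alpha> x \<circ> a" "a \<in> U orig" "b \<in> U orig" "a infty = neg x" "b x = infty"
    using *[OF g] by blast
  obtain a' b' where ab': "g' = b' \<circ> \<alpha> x \<circ> a'" "a' \<in> U orig" "b' \<in> U orig" "a' infty = neg x"
      "b' x = infty"
    using *[OF g'] by blast
  have "a = a'"
    by (rule root_unique[OF orig_in infty_in not_equiv]) (use ab ab' in auto)
  moreover have "b = b'"
    by (rule root_unique[OF orig_in units_X[OF assms]])
       (use assms rel_sym ab ab' in \<open>auto simp: units_iff\<close>)
  ultimately show "g = g'" using ab ab' by simp
qed

lemma mu_form:
  assumes "x \<in> units"
  obtains a b where "\<mu> x = b \<circ> \<alpha> x \<circ> a" "a \<in> U orig" "b \<in> U orig"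
  using theI'[OF mu_ex1[OF assms]] unfolding \<mu>_def by (auto simp: o_assoc)

lemma mu_swap: "x \<in> units \<Longrightarrow> \<mu> x orig = infty" "x \<in> units \<Longrightarrow> \<mu> x infty = orig"
  using theI'[OF mu_ex1] unfolding \<mu>_def by blast+

lemma mu_eqI:
  assumes "x \<in> units" "a \<in> U orig" "b \<in> U orig" "g = b \<circ> \<alpha> x \<circ> a" "g orig = infty" "g infty = orig"
  shows "\<mu> x = g"
  unfolding \<mu>_def
  by (rule the1_equality[OF mu_ex1[OF assms(1)]])
     (use assms(2-6) in \<open>force simp: o_assoc\<close>)

lemma mu_G: "x \<in> units \<Longrightarrow> \<mu> x \<in> little_projective_group"
  by (rule mu_form[of x])
     (auto intro!: G_comp intro: root_G[OF orig_in] root_G[OF infty_in] alpha_root units_R)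

lemma mu_S: "x \<in> units \<Longrightarrow> \<mu> x \<in> carrier S"
  using G_S mu_G by blast

text \<open>The inverse of \<open>b \<circ> \<alpha> x \<circ> a\<close> has the same shape around
  \<open>\<alpha> (neg x)\<close> and still interchanges the base points.\<close>

lemma mu_neg:
  assumes "x \<in> units"
  shows "\<mu> (neg x) = ginv (\<mu> x)"
proof -
  obtain a b where ab: "\<mu> x = b \<circ> \<alpha> x \<circ> a" "a \<in> U orig" "b \<in> U orig"
    using mu_form[OF assms] .
  have S: "a \<in> carrier S" "b \<in> carrier S" "\<alpha> x \<in> carrier S"
    using ab root_S[OF orig_in] alpha_S units_R[OF assms] by auto
  have "ginv (\<mu> x) = ginv a \<circ> \<alpha> (neg x) \<circ> ginv b"
    unfolding alpha_neg[OF units_R[OF assms]]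
  proof (rule inv_unique_comp)
    show "\<mu> x \<circ> (ginv a \<circ> ginv (\<alpha> x) \<circ> ginv b) = id" "ginv a \<circ> ginv (\<alpha> x) \<circ> ginv b \<circ> \<mu> x = id"
      using S by (auto simp: ab(1) fun_eq_iff)
  qed
  moreover have "ginv (\<mu> x) orig = infty" "ginv (\<mu> x) infty = orig"
    using mu_swap[OF assms] mu_S[OF assms] by (simp_all add: inv_eq_iff)
  ultimately show ?thesis
    using mu_eqI neg_units[OF assms] root_inv[OF orig_in] ab(2,3) by blast
qed

lemma mu_rel:
  assumes "x \<in> units" "t \<in> X"
  shows "(\<mu> x t, infty) \<in> r \<longleftrightarrow> (t, orig) \<in> r" "(\<mu> x t, orig) \<in> r \<longleftrightarrow> (t, infty) \<in> r"
  using rel_S[OF mu_S[OF assms(1)] assms(2) orig_in] rel_S[OF mu_S[OF assms(1)] assms(2) infty_in]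
  by (auto simp: mu_swap assms)

lemma mu_units_iff: "x \<in> units \<Longrightarrow> \<mu> x t \<in> units \<longleftrightarrow> t \<in> units"
  using mu_rel[of x t] in_X_S[OF mu_S, of x t] by (auto simp: units_def)

section \<open>The stabilizer of both base points\<close>

lemma stab_S: "h \<in> stab \<Longrightarrow> h \<in> carrier S"
  by (simp add: stab_def G_S)

lemma stab_inv: "h \<in> stab \<Longrightarrow> ginv h \<in> stab"
  by (auto simp: stab_def G_inv G_S inv_eq_iff)

lemma stab_mu_mu: "x \<in> units \<Longrightarrow> y \<in> units \<Longrightarrow> \<mu> x \<circ> \<mu> y \<in> stab"
  by (auto simp: stab_def G_comp mu_G mu_swap)

lemma stab_R_iff:
  assumes "h \<in> stab"
  shows "h x \<in> R \<longleftrightarrow> x \<in> R"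
  using assms rel_S[OF stab_S[OF assms] infty_in, of x] in_X_S[OF stab_S[OF assms], of x]
  by (auto simp: R_iff stab_def)

lemma stab_units_iff:
  assumes "h \<in> stab"
  shows "h x \<in> units \<longleftrightarrow> x \<in> units"
  using assms stab_R_iff[OF assms, of x] rel_S[OF stab_S[OF assms] _ orig_in, of x] R_X
  by (auto simp: units_iff stab_def)

text \<open>By (LM3) the conjugate lies in \<open>U infty\<close>, since \<open>h\<close> fixes
  \<open>infty\<close>; it sends \<open>orig\<close> to \<open>h x\<close>. Additivity of
  \<open>h\<close> follows.\<close>

lemma stab_alpha:
  assumes "h \<in> stab" "x \<in> R"
  shows "\<alpha> (h x) = h \<circ> \<alpha> x \<circ> ginv h"
proof (rule alpha_eqI)
  show "h \<circ> \<alpha> x \<circ> ginv h \<in> U infty"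
    using root_conj[OF infty_in, of h "\<alpha> x"] assms alpha_root by (auto simp: stab_def)
  show "(h \<circ> \<alpha> x \<circ> ginv h) orig = h x"
    using stab_inv[OF assms(1)] alpha_orig[OF assms(2)] by (auto simp: stab_def)
qed

lemma stab_padd:
  assumes "h \<in> stab" "x \<in> R" "y \<in> R"
  shows "h (x \<boxplus> y) = h x \<boxplus> h y"
  using assms by (simp add: padd_eq stab_R_iff stab_alpha stab_S)

lemma stab_neg:
  assumes "h \<in> stab" "x \<in> R"
  shows "h (neg x) = neg (h x)"
proof -
  have "\<alpha> (h x) (h (neg x)) = orig"
    using assms by (simp add: stab_alpha stab_S alpha_of_neg) (simp add: stab_def)
  then show ?thesis
    using assms neg_eq[of "h x"] stab_R_iff[OF assms(1)] alpha_S inv_eq_iff by metis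
qed

end


section \<open>Special local Moufang sets with abelian root groups and Hua subgroup\<close>

locale special_abelian_local_moufang_set = pointed_local_moufang_set X r U orig infty
  for X :: "'a set" and r :: "('a \<times> 'a) set" and U :: "'a \<Rightarrow> ('a \<Rightarrow> 'a) set"
    and orig infty :: 'a +
  fixes e :: 'a
  assumes is_special: special
    and root_comm: "comm_group (S\<lparr>carrier := U infty\<rparr>)"
    and hua_comm: "comm_group (S\<lparr>carrier := hua_subgroup\<rparr>)"
    and twice_units: "x \<in> units \<Longrightarrow> twice x \<in> units"
    and e_units: "e \<in> units"
begin

section \<open>The additive group of \<open>R\<close>\<close>

lemma e_R: "e \<in> R"
  by (rule units_R[OF e_units])

lemma root_commute: "g \<in> U infty \<Longrightarrow> h \<in> U infty \<Longrightarrow> g \<circ> h = h \<circ> g"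
  using comm_monoid.m_comm[OF comm_group.axioms(1)[OF root_comm], of g h] by simp

lemma hua_commute: "g \<in> hua_subgroup \<Longrightarrow> h \<in> hua_subgroup \<Longrightarrow> g \<circ> h = h \<circ> g"
  using comm_monoid.m_comm[OF comm_group.axioms(1)[OF hua_comm], of g h] by simp

lemma padd_comm: "x \<in> R \<Longrightarrow> y \<in> R \<Longrightarrow> x \<boxplus> y = y \<boxplus> x"
  using root_commute[of "\<alpha> x" "\<alpha> y"] alpha_root by (simp add: padd_def)

text \<open>The identity is set to \<open>e\<close> from the start; \<open>pmul_e\<close> justifies
  this.\<close>

abbreviation A :: "'a ring" where "A \<equiv> hua_ring e e"

lemma A_simps [simp]: "carrier A = R" "zero A = orig" "add A = padd" "one A = e" "mult A = pmul e"
  by (simp_all add: hua_ring_def)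

lemma abelian_group_A: "abelian_group A"
proof (rule abelian_groupI)
  fix x assume "x \<in> carrier A"
  then show "\<exists>y\<in>carrier A. y \<oplus>\<^bsub>A\<^esub> x = \<zero>\<^bsub>A\<^esub>"
    using padd_neg neg_R by auto
next
  fix x y assume "x \<in> carrier A" "y \<in> carrier A"
  then show "x \<oplus>\<^bsub>A\<^esub> y = y \<oplus>\<^bsub>A\<^esub> x"
    using padd_comm by simp
next
  fix x assume "x \<in> carrier A"
  then show "\<zero>\<^bsub>A\<^esub> \<oplus>\<^bsub>A\<^esub> x = x"
    by (simp add: padd_def alpha_zero alpha_orig)
qed (simp_all add: padd_closed padd_assoc orig_R)

lemma neg_A: "x \<in> R \<Longrightarrow> \<ominus>\<^bsub>A\<^esub> x = neg x"
  using abelian_group.minus_equality[OF abelian_group_A] padd_neg neg_R by simp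

lemma padd_lcomm: "x \<in> R \<Longrightarrow> y \<in> R \<Longrightarrow> z \<in> R \<Longrightarrow> x \<boxplus> (y \<boxplus> z) = y \<boxplus> (x \<boxplus> z)"
  using padd_assoc padd_comm by metis

lemma padd_zero: "x \<in> R \<Longrightarrow> orig \<boxplus> x = x" "x \<in> R \<Longrightarrow> x \<boxplus> orig = x"
  by (simp_all add: padd_eq orig_R alpha_orig alpha_zero)

lemma neg_zero: "neg orig = orig"
  using padd_neg[OF orig_R] by (simp add: padd_zero neg_R orig_R)

lemma padd_neg': "x \<in> R \<Longrightarrow> x \<boxplus> neg x = orig"
  using padd_neg padd_comm neg_R by metis

lemma padd_neg_left:
  assumes "x \<in> R" "y \<in> R"
  shows "x \<boxplus> (neg x \<boxplus> y) = y" "neg x \<boxplus> (x \<boxplus> y) = y"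
  using assms by (simp_all add: padd_assoc[symmetric] neg_R padd_neg padd_neg' padd_zero)

lemma neg_neg: "x \<in> R \<Longrightarrow> neg (neg x) = x"
  by (metis alpha_neg alpha_orig alpha_S inv_apply(5) neg_R)

lemma neg_padd: "x \<in> R \<Longrightarrow> y \<in> R \<Longrightarrow> neg (x \<boxplus> y) = neg x \<boxplus> neg y"
  using abelian_group.minus_add[OF abelian_group_A, of x y] by (simp add: neg_A padd_closed)

text \<open>The ordering used by the \<open>algebra\<close> method does not place \<open>x\<close> next to \<open>neg x\<close>, so
  cancellation across intermediate summands needs rules of its own.\<close>

lemma padd_neg_across:
  assumes "x \<in> R" "y \<in> R"
  shows "x \<boxplus> (y \<boxplus> neg x) = y"
    "v \<in> R \<Longrightarrow> x \<boxplus> (y \<boxplus> (neg x \<boxplus> v)) = y \<boxplus> v"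
    "z \<in> R \<Longrightarrow> x \<boxplus> (y \<boxplus> (z \<boxplus> neg x)) = y \<boxplus> z"
    "z \<in> R \<Longrightarrow> v \<in> R \<Longrightarrow> x \<boxplus> (y \<boxplus> (z \<boxplus> (neg x \<boxplus> v))) = y \<boxplus> (z \<boxplus> v)"
    "z \<in> R \<Longrightarrow> w \<in> R \<Longrightarrow> x \<boxplus> (y \<boxplus> (z \<boxplus> (w \<boxplus> neg x))) = y \<boxplus> (z \<boxplus> w)"
    "z \<in> R \<Longrightarrow> w \<in> R \<Longrightarrow> v \<in> R \<Longrightarrow>
      x \<boxplus> (y \<boxplus> (z \<boxplus> (w \<boxplus> (neg x \<boxplus> v)))) = y \<boxplus> (z \<boxplus> (w \<boxplus> v))"
  using assms
  by (simp_all add: padd_lcomm[of x] padd_closed neg_R padd_neg_left padd_neg' padd_zero)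

lemmas R_group [algebra R_group orig padd neg] =
  orig_R padd_closed neg_R padd_assoc padd_comm padd_lcomm padd_zero neg_zero padd_neg padd_neg'
  padd_neg_left padd_neg_across neg_neg neg_padd

lemma padd_cancel: "x \<in> R \<Longrightarrow> y \<in> R \<Longrightarrow> z \<in> R \<Longrightarrow> x \<boxplus> y = x \<boxplus> z \<longleftrightarrow> y = z"
  by (metis padd_neg_left(2))

section \<open>Units and non-units under addition\<close>

lemma double_units: "x \<in> units \<Longrightarrow> x \<boxplus> x \<in> units"
  using twice_units by (simp add: twice_def padd_def)

lemma padd_rel:
  assumes "x \<in> R" "y \<in> R" "z \<in> R" "(y, z) \<in> r"
  shows "(x \<boxplus> y, x \<boxplus> z) \<in> r"
  using rel_S[OF alpha_S[OF assms(1)], of y z] assms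
  by (simp add: padd_comm[of x] padd_eq[of _ x] R_X)

lemma nonunit_iff: "x \<in> R - units \<longleftrightarrow> x \<in> R \<and> (x, orig) \<in> r"
  by (auto simp: units_iff)

text \<open>As \<open>y\<close> is equivalent to \<open>orig\<close>, the sum is equivalent to
  \<open>x\<close>.\<close>

lemma unit_padd_nonunit:
  assumes "x \<in> units" "y \<in> R - units"
  shows "x \<boxplus> y \<in> units"
  using assms padd_rel[of x y orig] rel_sym rel_trans[of x "x \<boxplus> y" orig]
  by (auto simp: units_iff padd_closed orig_R padd_zero)

lemma nonunit_padd: "x \<in> R - units \<Longrightarrow> y \<in> R - units \<Longrightarrow> x \<boxplus> y \<in> R - units"
  unfolding nonunit_iff
  using padd_rel[of x y orig] rel_trans[of "x \<boxplus> y" x orig]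
  by (simp add: padd_closed orig_R padd_zero)

lemma nonunit_neg: "x \<in> R - units \<Longrightarrow> neg x \<in> R - units"
  using neg_units[of "neg x"] neg_neg[of x] neg_R by auto

lemma orig_nonunit: "orig \<in> R - units"
  unfolding nonunit_iff using orig_R rel_refl orig_in by simp

text \<open>\<open>special\<close> concerns a single \<mu>-map \<open>\<mu> w\<close>. Any other one
  is \<open>\<mu> w\<close> followed by an element of \<open>stab\<close>, which commutes with
  negation.\<close>

lemma mu_neg_arg:
  assumes "y \<in> units" "x \<in> units"
  shows "\<mu> y (neg x) = neg (\<mu> y x)"
proof -
  obtain w where w: "w \<in> units" "\<And>x. x \<in> units \<Longrightarrow> \<mu> w (neg x) = neg (\<mu> w x)"
    using is_special unfolding special_def by auto
  let ?h = "\<mu> y \<circ> \<mu> (neg w)"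
  have h: "?h \<in> stab" by (simp add: stab_mu_mu assms w neg_units)
  have *: "?h (\<mu> w v) = \<mu> y v" for v
    using w(1) by (simp add: mu_neg mu_S)
  show ?thesis
    using stab_neg[OF h units_R[of "\<mu> w x"]] w(1) assms(2)
    by (simp add: w(2)[symmetric] mu_units_iff * del: o_apply)
qed

lemma mu_mu_neg [simp]:
  assumes "x \<in> units"
  shows "\<mu> x (\<mu> (neg x) t) = t" "\<mu> (neg x) (\<mu> x t) = t"
  using assms by (simp_all add: mu_neg mu_S)

text \<open>Conjugation by \<open>\<mu> w\<close> carries \<open>U infty\<close> into
  \<open>U orig\<close>. Specialness gives \<open>c infty = neg x\<close>, while
  \<open>c x = infty\<close> is direct, so by sharp transitivity \<open>c\<close> is both the first
  and the last factor of \<open>\<mu> x\<close>.\<close>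

lemma mu_palindrome:
  assumes w: "w \<in> units" and x: "x \<in> units"
  defines "c \<equiv> \<mu> w \<circ> \<alpha> (neg (\<mu> (neg w) x)) \<circ> \<mu> (neg w)"
  shows "\<mu> x = c \<circ> \<alpha> x \<circ> c" "c \<in> U orig" "c infty = neg x"
proof -
  let ?y = "\<mu> (neg w) x"
  have y: "?y \<in> units" using w x by (simp add: mu_units_iff neg_units)
  have gam: "\<mu> w \<circ> \<alpha> v \<circ> \<mu> (neg w) \<in> U orig" if "v \<in> R" for v
    using root_conj[OF infty_in mu_G[OF w] alpha_root[OF that]] w by (simp add: mu_neg mu_swap)
  show c: "c \<in> U orig"
    unfolding c_def by (rule gam) (simp add: neg_R y units_R)
  show cinf: "c infty = neg x"
    using w x y by (simp add: c_def mu_swap neg_units alpha_orig neg_R units_R mu_neg_arg)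
  obtain a b where ab: "\<mu> x = b \<circ> \<alpha> x \<circ> a" "a \<in> U orig" "b \<in> U orig"
    using mu_form[OF x] .
  have S: "a \<in> carrier S" "b \<in> carrier S" "c \<in> carrier S" using ab c root_S[OF orig_in] by auto
  have "b (\<alpha> x (a infty)) = b orig"
    using ab(1) LM2_fix[OF orig_in ab(3)] mu_swap(2)[OF x] by simp
  then have "a infty = neg x"
    using S x by (metis inv_apply(1) neg_eq units_R alpha_S)
  then have "a = c"
    using root_unique[OF orig_in infty_in not_equiv ab(2) c] cinf by simp
  have "b (\<alpha> x (a orig)) = infty"
    using mu_swap(1)[OF x] ab(1) by simp
  then have "b x = infty"
    using LM2_fix[OF orig_in ab(2)] x by (simp add: alpha_orig units_R)
  moreover have "c x = infty"
    using w x y by (simp add: c_def mu_swap neg_units alpha_orig neg_R units_R alpha_neg alpha_S)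
       (metis alpha_S alpha_orig inv_eq_iff units_R mu_swap(1))
  ultimately have "b = c"
    using root_unique[OF orig_in units_X[OF x] _ ab(3) c] x rel_sym by (auto simp: units_iff)
  with \<open>a = c\<close> ab show "\<mu> x = c \<circ> \<alpha> x \<circ> c" by simp
qed

text \<open>In \<open>c \<circ> \<alpha> x \<circ> c\<close> the inner \<open>c\<close> sends
  \<open>x\<close> to \<open>infty\<close>, which \<open>\<alpha> x\<close> fixes, and the outer
  \<open>c\<close> sends \<open>infty\<close> to \<open>neg x\<close>.\<close>

lemma mu_self:
  assumes "x \<in> units"
  shows "\<mu> x x = neg x" "\<mu> x (neg x) = x"
proof -
  define c where "c = \<mu> e \<circ> \<alpha> (neg (\<mu> (neg e) x)) \<circ> \<mu> (neg e)"
  note c = mu_palindrome[OF e_units assms, folded c_def]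
  have "c (\<alpha> x (c orig)) = infty"
    using mu_swap(1)[OF assms] c(1) by simp
  then have "c x = infty"
    using LM2_fix[OF orig_in c(2)] assms by (simp add: alpha_orig units_R)
  then show "\<mu> x x = neg x"
    using c(1,3) assms by (simp add: alpha_infty units_R)
  then show "\<mu> x (neg x) = x"
    using assms by (simp add: mu_neg_arg neg_neg units_R)
qed

text \<open>The factor \<open>c\<close> of the palindrome does not depend on \<open>w\<close>, being
  determined by \<open>c infty = neg x\<close>. For \<open>w = x\<close> it is
  \<open>\<alpha> x\<close> conjugated by \<open>\<mu> x\<close>, so
  \<open>c \<circ> \<mu> x = \<mu> x \<circ> \<alpha> x\<close>; inserting the palindrome and
  cancelling \<open>c\<close> gives the claim.\<close>

lemma mu_braid:
  assumes w: "w \<in> units" and x: "x \<in> units"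
  shows "\<mu> x = \<alpha> x \<circ> (\<mu> w \<circ> \<alpha> (neg (\<mu> (neg w) x)) \<circ> \<mu> (neg w)) \<circ> \<alpha> x"
proof -
  define c where "c = \<mu> w \<circ> \<alpha> (neg (\<mu> (neg w) x)) \<circ> \<mu> (neg w)"
  define d where "d = \<mu> x \<circ> \<alpha> (neg (\<mu> (neg x) x)) \<circ> \<mu> (neg x)"
  note c = mu_palindrome[OF w x, folded c_def]
  note d = mu_palindrome[OF x x, folded d_def]
  have cd: "c = d"
    using root_unique[OF orig_in infty_in not_equiv c(2) d(2)] c d by simp
  have S: "c \<in> carrier S" using c root_S[OF orig_in] by auto
  have "\<mu> (neg x) x = neg x"
    using mu_self(1)[OF x] mu_mu_neg(2)[OF x, of x] mu_self(2)[OF neg_units[OF x]] x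
    by (simp add: neg_neg units_R)
  then have "d \<circ> \<mu> x = \<mu> x \<circ> \<alpha> x"
    using x by (simp add: d_def fun_eq_iff neg_neg units_R)
  then have "c \<circ> (c \<circ> \<alpha> x \<circ> c) = c \<circ> (\<alpha> x \<circ> c \<circ> \<alpha> x)"
    using c(1) cd by (simp add: o_assoc)
  then have "c \<circ> \<alpha> x \<circ> c = \<alpha> x \<circ> c \<circ> \<alpha> x"
    using S by (metis (no_types) inv_apply(3) comp_assoc id_comp)
  then show ?thesis using c(1) by (simp add: c_def)
qed

text \<open>The braid form for \<open>w = e\<close>, evaluated at \<open>t\<close>.\<close>

lemma mu_formula:
  assumes t: "t \<in> units" and x: "x \<in> units" and tx: "t \<boxplus> x \<in> units"
  defines "v \<equiv> \<mu> (neg e) (t \<boxplus> x) \<boxminus> \<mu> (neg e) x"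
  shows "v \<in> units" "\<mu> x t = \<mu> e v \<boxplus> x"
proof -
  let ?y = "\<mu> (neg e) x"
  have y: "?y \<in> units" "\<mu> (neg e) (t \<boxplus> x) \<in> units"
    using x tx by (simp_all add: mu_units_iff neg_units e_units)
  have vR: "v \<in> R"
    using y by (simp add: v_def padd_closed neg_R units_R)
  have "v = \<alpha> (neg ?y) (\<mu> (neg e) (\<alpha> x t))"
    using y t by (simp add: v_def padd_eq units_R)
  then have eq: "\<mu> x t = \<alpha> x (\<mu> e v)"
    using fun_cong[OF mu_braid[OF e_units x], of t] by simp
  \<comment> \<open>\<open>padd_eq\<close> requires its first summand in \<open>R\<close>, so
    membership of \<open>\<mu> e v\<close> is obtained first, by undoing
    \<open>\<alpha> x\<close>.\<close>
  then have "\<mu> e v = \<alpha> (neg x) (\<mu> x t)"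
    using x by (simp add: alpha_neg alpha_S units_R)
  then have R: "\<mu> e v \<in> R"
    using x t by (simp add: root_infty_R alpha_root neg_R units_R mu_units_iff)
  then have "(\<mu> e v, infty) \<notin> r"
    using rel_sym by (auto simp: R_iff)
  then show "v \<in> units"
    using mu_rel[OF e_units, of v] vR by (simp add: units_iff R_X)
  show "\<mu> x t = \<mu> e v \<boxplus> x"
    using eq R by (simp add: padd_eq)
qed

text \<open>\<open>mu_formula\<close> for the pairs \<open>t\<close>, \<open>y\<close> and
  \<open>neg t\<close>, \<open>t \<boxplus> y\<close> produces opposite values of \<open>v\<close>;
  specialness then eliminates \<open>\<mu> e v\<close> between the two equations.\<close>

lemma mu_sum:
  assumes t: "t \<in> units" and y: "y \<in> units" and ty: "t \<boxplus> y \<in> units"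
  shows "\<mu> (t \<boxplus> y) (neg t) = \<mu> y (neg t) \<boxplus> (y \<boxplus> y) \<boxplus> t"
proof -
  let ?u = "\<mu> (neg e) (t \<boxplus> y)" and ?w = "\<mu> (neg e) y"
  have u: "?u \<in> units" "?w \<in> units"
    using assms by (simp_all add: mu_units_iff neg_units e_units)
  have y_eq: "neg t \<boxplus> (t \<boxplus> y) = y"
    using t y by (simp add: padd_neg_left units_R)
  note 1 = mu_formula[OF t y ty]
  note 2 = mu_formula[OF neg_units[OF t] ty, unfolded y_eq, OF y]
  let ?v = "?u \<boxminus> ?w"
  have v: "\<mu> e ?v \<in> R"
    using 1(1) by (simp add: mu_units_iff e_units units_R)
  have "?w \<boxminus> ?u = neg ?v"
    using u[THEN units_R] by algebra
  then have "\<mu> (t \<boxplus> y) (neg t) = neg (\<mu> e ?v) \<boxplus> (t \<boxplus> y)"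
    using 2(2) 1(1) by (simp add: mu_neg_arg e_units)
  also have "\<dots> = neg (\<mu> e ?v \<boxplus> y) \<boxplus> (y \<boxplus> y) \<boxplus> t"
    using v t[THEN units_R] y[THEN units_R] by algebra
  also have "neg (\<mu> e ?v \<boxplus> y) = \<mu> y (neg t)"
    using 1(2) t y by (simp add: mu_neg_arg)
  finally show ?thesis .
qed

section \<open>Unique divisibility by two\<close>

text \<open>In \<open>mu_formula\<close> with \<open>t = x\<close> the left side is
  \<open>neg x\<close>. Hence \<open>\<mu> e v = neg (x \<boxplus> x)\<close>, that is,
  \<open>v = neg ?u\<close>, which rearranges to the claim.\<close>

lemma mu_double:
  assumes x: "x \<in> units"
  shows "\<mu> (neg e) (x \<boxplus> x) \<boxplus> \<mu> (neg e) (x \<boxplus> x) = \<mu> (neg e) x"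
proof -
  let ?u = "\<mu> (neg e) (x \<boxplus> x)" and ?w = "\<mu> (neg e) x"
  have u: "?u \<in> units" "?w \<in> units"
    using assms by (simp_all add: mu_units_iff neg_units e_units double_units)
  note 1 = mu_formula[OF x x double_units[OF x]]
  let ?v = "?u \<boxminus> ?w"
  have v: "\<mu> e ?v \<in> R"
    using 1(1) by (simp add: mu_units_iff e_units units_R)
  have "\<mu> e ?v = (\<mu> e ?v \<boxplus> x) \<boxplus> neg x"
    using v x[THEN units_R] by algebra
  also have "\<dots> = neg x \<boxplus> neg x"
    using 1(2) x by (simp add: mu_self)
  also have "\<dots> = neg (x \<boxplus> x)"
    using x[THEN units_R] by algebra
  finally have "\<mu> (neg e) (\<mu> e ?v) = neg ?u"
    using x by (simp add: mu_neg_arg double_units neg_units e_units)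
  then have "?u \<boxplus> ?v = ?u \<boxplus> neg ?u"
    using e_units by simp
  then have "?u \<boxplus> ?v \<boxplus> ?w = ?u \<boxplus> neg ?u \<boxplus> ?w"
    by simp
  moreover have "?u \<boxplus> ?v \<boxplus> ?w = ?u \<boxplus> ?u" "?u \<boxplus> neg ?u \<boxplus> ?w = ?w"
    using u[THEN units_R] by (algebra, algebra)
  ultimately show ?thesis by simp
qed

text \<open>For units, \<open>mu_double\<close> recovers \<open>x\<close> from
  \<open>x \<boxplus> x\<close>. In general the difference \<open>u\<close> doubles to
  \<open>orig\<close>, so it is a non-unit by (R4), and the unit case applies to
  \<open>e \<boxplus> u\<close> and \<open>e\<close>.\<close>

lemma double_cancel:
  assumes "x \<in> R" "y \<in> R" "x \<boxplus> x = y \<boxplus> y"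
  shows "x = y"
proof -
  have *: "x = y" if "x \<in> units" "y \<in> units" "x \<boxplus> x = y \<boxplus> y" for x y
    using mu_double[OF that(1)] mu_double[OF that(2)] that
    by (metis e_units mu_mu_neg(1))
  define u where "u = x \<boxminus> y"
  have u: "u \<in> R" "u \<boxplus> u = (x \<boxplus> x) \<boxminus> (y \<boxplus> y)"
    unfolding u_def using assms(1,2) by (algebra, algebra)
  then have u0: "u \<boxplus> u = orig"
    using assms by (simp add: padd_neg' padd_closed)
  then have "u \<in> R - units"
    using u(1) double_units[of u] orig_nonunit by auto
  then have "e \<boxplus> u \<in> units"
    by (rule unit_padd_nonunit[OF e_units])
  moreover have "(e \<boxplus> u) \<boxplus> (e \<boxplus> u) = (e \<boxplus> e) \<boxplus> (u \<boxplus> u)"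
    using u(1) e_R by algebra
  ultimately have "e \<boxplus> u = e \<boxplus> orig"
    using *[of "e \<boxplus> u" e] e_units u0 by (simp add: padd_zero padd_closed e_R)
  then have "u = orig"
    using u(1) e_R orig_R by (simp add: padd_cancel)
  then have "u \<boxplus> y = y"
    using assms(2) by (simp add: padd_zero)
  moreover have "u \<boxplus> y = x"
    unfolding u_def using assms(1,2) by algebra
  ultimately show ?thesis by simp
qed

lemma half_ex:
  assumes "z \<in> R"
  shows "\<exists>w\<in>R. w \<boxplus> w = z"
proof -
  have *: "\<exists>w\<in>R. w \<boxplus> w = z" if "z \<in> units" for z
  proof -
    \<comment> \<open>The half of \<open>z\<close> is read off from \<open>mu_double\<close> for the
      unit \<open>\<mu> e z\<close>.\<close>
    let ?w = "\<mu> (neg e) (\<mu> e z \<boxplus> \<mu> e z)"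
    have z: "\<mu> e z \<in> units" using that by (simp add: mu_units_iff e_units)
    have "?w \<boxplus> ?w = z"
      using mu_double[OF z] unfolding mu_mu_neg(2)[OF e_units] .
    moreover have "?w \<in> units"
      using double_units[OF z] mu_units_iff[OF neg_units[OF e_units]] by blast
    ultimately show ?thesis
      using units_R by blast
  qed
  show ?thesis
  proof (cases "z \<in> units")
    case False
    \<comment> \<open>A non-unit is the difference of the units \<open>e \<boxplus> z\<close> and
      \<open>e\<close>, both of which have halves.\<close>
    then have "e \<boxplus> z \<in> units" using assms by (simp add: unit_padd_nonunit e_units)
    then obtain w where w: "w \<in> R" "w \<boxplus> w = e \<boxplus> z" using * by blast
    obtain f where f: "f \<in> R" "f \<boxplus> f = e" using * e_units by blast
    have "(w \<boxminus> f) \<boxplus> (w \<boxminus> f) = (w \<boxplus> w) \<boxminus> (f \<boxplus> f)" "w \<boxminus> f \<in> R" "(e \<boxplus> z) \<boxminus> e = z"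
      using w(1) f(1) e_R assms by (algebra, algebra, algebra)
    from this(1) have "(w \<boxminus> f) \<boxplus> (w \<boxminus> f) = z"
      unfolding w(2) f(2) \<open>(e \<boxplus> z) \<boxminus> e = z\<close> .
    with \<open>w \<boxminus> f \<in> R\<close> show ?thesis by blast
  qed (rule *)
qed

lemma half_R: "z \<in> R \<Longrightarrow> half z \<in> R"
  and double_half: "z \<in> R \<Longrightarrow> half z \<boxplus> half z = z"
proof -
  assume "z \<in> R"
  then have "\<exists>!w. w \<in> R \<and> w \<boxplus> w = z"
    using half_ex double_cancel by metis
  from theI'[OF this] show "half z \<in> R" "half z \<boxplus> half z = z"
    unfolding half_def by auto
qed

section \<open>The multiplication\<close>

lemma hua_apply: "hua e x t = \<mu> x (\<mu> e t)"
  by (simp add: hua_def)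

lemma hua_stab: "x \<in> units \<Longrightarrow> hua e x \<in> stab"
  by (simp add: hua_def stab_mu_mu e_units)

lemma hua_R: "x \<in> units \<Longrightarrow> t \<in> R \<Longrightarrow> hua e x t \<in> R"
  using stab_R_iff[OF hua_stab] by blast

lemma hua_padd: "x \<in> units \<Longrightarrow> s \<in> R \<Longrightarrow> t \<in> R \<Longrightarrow> hua e x (s \<boxplus> t) = hua e x s \<boxplus> hua e x t"
  by (rule stab_padd[OF hua_stab])

lemma hua_hua_commute:
  assumes "x \<in> units" "y \<in> units"
  shows "hua e x (hua e y t) = hua e y (hua e x t)"
proof -
  have "hua e z \<in> hua_subgroup" if "z \<in> units" for z
    unfolding hua_subgroup_def hua_def using that e_units by (auto intro!: generate.incl)
  then show ?thesis
    using fun_cong[OF hua_commute, of "hua e x" "hua e y" t] assms by simp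
qed

text \<open>The sum of the non-unit \<open>y \<boxplus> e\<close> and
  \<open>neg (e \<boxplus> e)\<close>, a unit by (R4). It shows that the second formula for
  \<open>rmul\<close> involves only unit indices.\<close>

lemma neg_e_padd_unit:
  assumes "y \<in> units" "y \<boxplus> e \<notin> units"
  shows "neg e \<boxplus> y \<in> units"
proof -
  have "neg (e \<boxplus> e) \<boxplus> (y \<boxplus> e) \<in> units"
    using assms by (simp add: unit_padd_nonunit neg_units double_units e_units padd_closed units_R)
  moreover have "neg (e \<boxplus> e) \<boxplus> (y \<boxplus> e) = neg e \<boxplus> y"
    using units_R[OF assms(1)] e_R by algebra
  ultimately show ?thesis by simp
qed

lemma rmul_cases:
  assumes "y \<in> R"
  obtains
    (1) "y \<in> units" "e \<boxplus> y \<in> units"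
        "\<And>x. rmul e y x = hua e (e \<boxplus> y) x \<boxminus> hua e y x \<boxminus> x"
  | (2) "y \<in> units" "neg e \<boxplus> y \<in> units"
        "\<And>x. rmul e y x = neg (hua e (neg e \<boxplus> y) x) \<boxplus> x \<boxplus> hua e y x"
  | (3) "e \<boxplus> y \<in> units" "e \<boxplus> e \<boxplus> y \<in> units" "neg (e \<boxplus> e) \<in> units"
        "\<And>x. rmul e y x =
          hua e (e \<boxplus> e \<boxplus> y) x \<boxminus> hua e (e \<boxplus> y) x \<boxminus> hua e (neg (e \<boxplus> e)) x \<boxplus> x"
proof -
  consider "y \<in> units" "y \<boxplus> e \<in> units" | "y \<in> units" "y \<boxplus> e \<notin> units" | "y \<notin> units"
    by blast
  then show thesis
  proof cases
    assume y: "y \<in> units" "y \<boxplus> e \<in> units"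
    show thesis
    proof (rule 1)
      show "e \<boxplus> y \<in> units" using y padd_comm[OF assms e_R] by simp
    qed (use y in \<open>simp_all add: rmul_def\<close>)
  next
    assume "y \<in> units" "y \<boxplus> e \<notin> units"
    then show thesis by (intro 2) (simp_all add: neg_e_padd_unit rmul_def)
  next
    assume "y \<notin> units"
    with assms show thesis
      by (intro 3) (simp_all add: rmul_def unit_padd_nonunit e_units double_units neg_units)
  qed
qed

lemma rmul_R: "x \<in> R \<Longrightarrow> y \<in> R \<Longrightarrow> rmul e y x \<in> R"
  by (rule rmul_cases[of y]) (simp_all add: hua_R padd_closed neg_R)

text \<open>Each \<open>rmul e y\<close> is an integral combination of Hua maps and the identity.
  Applied with a Hua map as \<open>f\<close>, and then, through \<open>hua_rmul\<close>, with
  another \<open>rmul\<close>.\<close>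

lemma rmul_commute:
  assumes f: "\<And>x. x \<in> R \<Longrightarrow> f x \<in> R"
    and f_add: "\<And>x y. x \<in> R \<Longrightarrow> y \<in> R \<Longrightarrow> f (x \<boxplus> y) = f x \<boxplus> f y"
    and f_hua: "\<And>z x. z \<in> units \<Longrightarrow> x \<in> R \<Longrightarrow> f (hua e z x) = hua e z (f x)"
    and x: "x \<in> R" and y: "y \<in> R"
  shows "f (rmul e y x) = rmul e y (f x)"
proof -
  have "f orig \<boxplus> f orig = f orig \<boxplus> orig"
    using f_add[of orig orig] by (simp add: orig_R padd_zero f)
  then have f0: "f orig = orig"
    by (simp add: padd_cancel f orig_R)
  have f_neg: "f (neg x) = neg (f x)" if "x \<in> R" for x
  proof -
    have "f x \<boxplus> f (neg x) = f x \<boxplus> neg (f x)"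
      using f_add[of x "neg x"] that f0 by (simp add: neg_R padd_neg' f)
    then show ?thesis using that by (simp add: padd_cancel f neg_R)
  qed
  show ?thesis
    using y
    by (rule rmul_cases) (simp_all add: f_add f_neg f_hua hua_R x f padd_closed neg_R)
qed

lemma rmul_padd:
  assumes "x \<in> R" "y \<in> R" "z \<in> R"
  shows "rmul e y (x \<boxplus> z) = rmul e y x \<boxplus> rmul e y z"
  using assms(2)
proof (cases rule: rmul_cases)
  case 1
  note h = hua_R[OF 1(1)] hua_R[OF 1(2)]
  show ?thesis
    unfolding 1(3) hua_padd[OF 1(1) assms(1,3)] hua_padd[OF 1(2) assms(1,3)]
    using h[OF assms(1)] h[OF assms(3)] assms by algebra
next
  case 2
  note h = hua_R[OF 2(1)] hua_R[OF 2(2)]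
  show ?thesis
    unfolding 2(3) hua_padd[OF 2(1) assms(1,3)] hua_padd[OF 2(2) assms(1,3)]
    using h[OF assms(1)] h[OF assms(3)] assms by algebra
next
  case 3
  note h = hua_R[OF 3(1)] hua_R[OF 3(2)] hua_R[OF 3(3)]
  show ?thesis
    unfolding 3(4) hua_padd[OF 3(1) assms(1,3)] hua_padd[OF 3(2) assms(1,3)]
      hua_padd[OF 3(3) assms(1,3)]
    using h[OF assms(1)] h[OF assms(3)] assms by algebra
qed

lemma hua_rmul: "z \<in> units \<Longrightarrow> x \<in> R \<Longrightarrow> y \<in> R \<Longrightarrow> hua e z (rmul e y x) = rmul e y (hua e z x)"
  by (rule rmul_commute) (simp_all add: hua_R hua_padd hua_hua_commute)

lemma rmul_rmul:
  "x \<in> R \<Longrightarrow> y \<in> R \<Longrightarrow> z \<in> R \<Longrightarrow> rmul e z (rmul e y x) = rmul e y (rmul e z x)"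
  by (rule rmul_commute) (simp_all add: rmul_R rmul_padd hua_rmul)

section \<open>The value of \<open>rmul e y\<close> at \<open>e\<close>\<close>

lemma hua_at_e: "hua e x e = \<mu> x (neg e)"
  by (simp add: hua_apply mu_self e_units)

text \<open>By \<open>hua_at_e\<close> this is the value at \<open>e\<close> of the Hua map of
  \<open>neg (e \<boxplus> e)\<close> in the third formula for \<open>rmul\<close>. It comes from
  \<open>mu_sum\<close> with both arguments \<open>neg e\<close>, followed by a change of
  sign.\<close>

lemma mu_minus_two:
  "\<mu> (neg (e \<boxplus> e)) (neg e) = e \<boxplus> e \<boxplus> e \<boxplus> e"
proof -
  have n: "neg e \<in> units" by (rule neg_units[OF e_units])
  have eq: "neg e \<boxplus> neg e = neg (e \<boxplus> e)" using e_R by algebra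
  have "neg (e \<boxplus> e) \<in> units" by (simp add: neg_units double_units e_units)
  then have "\<mu> (neg (e \<boxplus> e)) (neg (neg e)) = \<mu> (neg e) (neg (neg e)) \<boxplus> neg (e \<boxplus> e) \<boxplus> neg e"
    using mu_sum[OF n n] unfolding eq by blast
  then have "\<mu> (neg (e \<boxplus> e)) (neg (neg e)) = neg e \<boxplus> neg (e \<boxplus> e) \<boxplus> neg e"
    using mu_self(2)[OF n] by simp
  then have "\<mu> (neg (e \<boxplus> e)) (neg (neg (neg e))) = neg (neg e \<boxplus> neg (e \<boxplus> e) \<boxplus> neg e)"
    using mu_neg_arg[OF \<open>neg (e \<boxplus> e) \<in> units\<close> neg_units[OF n]] by simp
  moreover have "neg (neg e \<boxplus> neg (e \<boxplus> e) \<boxplus> neg e) = e \<boxplus> e \<boxplus> e \<boxplus> e"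
    using e_R by algebra
  ultimately show ?thesis using neg_neg[OF neg_R[OF e_R]] by simp
qed

text \<open>\<open>mu_sum\<close> with first summand \<open>e\<close> is used at \<open>y\<close>,
  \<open>neg e \<boxplus> y\<close> or \<open>e \<boxplus> y\<close> according to the formula for
  \<open>rmul\<close>; the value \<open>?p\<close> then cancels.\<close>

lemma rmul_e:
  assumes y: "y \<in> R"
  shows "rmul e y e = y \<boxplus> y"
  using y
proof (cases rule: rmul_cases)
  case 1
  let ?p = "\<mu> y (neg e)"
  have p: "?p \<in> R" using 1 by (simp add: mu_units_iff neg_units e_units units_R)
  have "rmul e y e = (?p \<boxplus> (y \<boxplus> y) \<boxplus> e) \<boxminus> ?p \<boxminus> e"
    using mu_sum[OF e_units 1(1,2)] by (simp add: 1(3) hua_at_e)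
  also have "\<dots> = y \<boxplus> y"
    using p y e_R by algebra
  finally show ?thesis .
next
  case 2
  let ?z = "neg e \<boxplus> y"
  let ?p = "\<mu> ?z (neg e)"
  have p: "?p \<in> R" using 2 by (simp add: mu_units_iff neg_units e_units units_R)
  have "e \<boxplus> ?z = y" using y e_R by algebra
  then have "rmul e y e = neg ?p \<boxplus> e \<boxplus> (?p \<boxplus> (?z \<boxplus> ?z) \<boxplus> e)"
    using mu_sum[OF e_units 2(2)] 2(1) by (simp add: 2(3) hua_at_e)
  also have "\<dots> = y \<boxplus> y"
    using p y e_R by algebra
  finally show ?thesis .
next
  case 3
  let ?z = "e \<boxplus> y"
  let ?p = "\<mu> ?z (neg e)"
  have p: "?p \<in> R" using 3 by (simp add: mu_units_iff neg_units e_units units_R)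
  have eq: "e \<boxplus> ?z = e \<boxplus> e \<boxplus> y" using y e_R by algebra
  have "rmul e y e = (?p \<boxplus> (?z \<boxplus> ?z) \<boxplus> e) \<boxminus> ?p \<boxminus> (e \<boxplus> e \<boxplus> e \<boxplus> e) \<boxplus> e"
    using mu_sum[OF e_units 3(1), unfolded eq, OF 3(2)] by (simp add: 3(4) hua_at_e mu_minus_two)
  also have "\<dots> = y \<boxplus> y"
    using p y e_R by algebra
  finally show ?thesis .
qed

lemma rmul_sym:
  assumes "x \<in> R" "y \<in> R"
  shows "rmul e y x = rmul e x y"
proof (rule double_cancel)
  have "rmul e y x \<boxplus> rmul e y x = rmul e y (rmul e x e)"
    using assms by (simp add: rmul_e rmul_padd)
  also have "\<dots> = rmul e x (rmul e y e)"
    using assms by (simp add: rmul_rmul e_R)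
  also have "\<dots> = rmul e x y \<boxplus> rmul e x y"
    using assms by (simp add: rmul_e rmul_padd)
  finally show "rmul e y x \<boxplus> rmul e y x = rmul e x y \<boxplus> rmul e x y" .
qed (simp_all add: rmul_R assms)

section \<open>The product and the ring axioms\<close>

lemma pmul_R: "x \<in> R \<Longrightarrow> y \<in> R \<Longrightarrow> pmul e x y \<in> R"
  by (simp add: pmul_def half_R rmul_R)

lemma double_pmul: "x \<in> R \<Longrightarrow> y \<in> R \<Longrightarrow> pmul e x y \<boxplus> pmul e x y = rmul e y x"
  by (simp add: pmul_def double_half rmul_R)

lemma pmul_comm: "x \<in> R \<Longrightarrow> y \<in> R \<Longrightarrow> pmul e x y = pmul e y x"
  by (simp add: pmul_def rmul_sym)

lemma pmul_e:
  assumes "y \<in> R"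
  shows "pmul e e y = y"
  by (rule double_cancel) (simp_all add: pmul_R double_pmul rmul_e assms e_R)

lemma pmul_padd:
  assumes "x \<in> R" "y \<in> R" "z \<in> R"
  shows "pmul e (x \<boxplus> y) z = pmul e x z \<boxplus> pmul e y z"
proof (rule double_cancel)
  let ?a = "pmul e x z" and ?b = "pmul e y z"
  have "(?a \<boxplus> ?b) \<boxplus> (?a \<boxplus> ?b) = (?a \<boxplus> ?a) \<boxplus> (?b \<boxplus> ?b)"
    using pmul_R[OF assms(1,3)] pmul_R[OF assms(2,3)] by algebra
  then show "pmul e (x \<boxplus> y) z \<boxplus> pmul e (x \<boxplus> y) z = (?a \<boxplus> ?b) \<boxplus> (?a \<boxplus> ?b)"
    using assms by (simp add: double_pmul rmul_padd padd_closed)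
qed (simp_all add: pmul_R padd_closed assms)

text \<open>Doubling twice turns the sides into \<open>rmul e z (rmul e y x)\<close> and
  \<open>rmul e y (rmul e z x)\<close>, which agree by \<open>rmul_rmul\<close>. Together with
  commutativity this yields associativity.\<close>

lemma pmul_right_commute:
  assumes "x \<in> R" "y \<in> R" "z \<in> R"
  shows "pmul e (pmul e x y) z = pmul e (pmul e x z) y"
proof (rule double_cancel, goal_cases)
  case 3
  have quad: "(pmul e (pmul e x y) z \<boxplus> pmul e (pmul e x y) z) \<boxplus>
      (pmul e (pmul e x y) z \<boxplus> pmul e (pmul e x y) z) = rmul e z (rmul e y x)"
    if "y \<in> R" "z \<in> R" for y z
    using that assms(1)
    by (simp add: double_pmul pmul_R flip: rmul_padd)
  show ?case
    by (rule double_cancel) (simp_all add: quad assms rmul_rmul pmul_R padd_closed)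
qed (simp_all add: pmul_R assms)

lemma pmul_assoc:
  assumes "x \<in> R" "y \<in> R" "z \<in> R"
  shows "pmul e (pmul e x y) z = pmul e x (pmul e y z)"
proof -
  have "pmul e (pmul e x y) z = pmul e (pmul e y x) z"
    using assms by (simp add: pmul_comm)
  also have "\<dots> = pmul e (pmul e y z) x"
    using assms by (simp add: pmul_right_commute)
  also have "\<dots> = pmul e x (pmul e y z)"
    using assms by (simp add: pmul_comm pmul_R)
  finally show ?thesis .
qed

lemma cring_A: "cring A"
proof (rule cringI)
  show "comm_monoid A"
    by (rule comm_monoidI) (simp_all add: pmul_R pmul_assoc pmul_e e_R, rule pmul_comm)
qed (simp_all add: abelian_group_A pmul_padd)

text \<open>The Hua map commutes with \<open>rmul e x\<close>, and \<open>rmul e x e\<close> is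
  \<open>x \<boxplus> x\<close>; so its value at \<open>e\<close> determines it.\<close>

lemma hua_pmul:
  assumes "z \<in> units" "x \<in> R"
  shows "hua e z x = pmul e x (hua e z e)"
proof (rule double_cancel)
  have "hua e z x \<boxplus> hua e z x = hua e z (rmul e x e)"
    using assms by (simp add: rmul_e hua_padd)
  also have "\<dots> = rmul e (hua e z e) x"
    using assms hua_rmul[OF assms(1) e_R assms(2)] rmul_sym[of x "hua e z e"]
    by (simp add: hua_R e_R)
  finally show "hua e z x \<boxplus> hua e z x = pmul e x (hua e z e) \<boxplus> pmul e x (hua e z e)"
    using assms by (simp add: double_pmul hua_R e_R)
qed (use assms in \<open>simp_all add: hua_R pmul_R e_R\<close>)

lemma hua_e_e: "hua e e e = e"
  by (simp add: hua_at_e mu_self e_units)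

text \<open>\<open>hua e e\<close> is multiplication by its value at \<open>e\<close>, which is
  \<open>e\<close> itself.\<close>

lemma mu_e_involution: "x \<in> R \<Longrightarrow> \<mu> e (\<mu> e x) = x"
  using hua_pmul[OF e_units, of x] pmul_comm[of x e] pmul_e[of x] e_R
  by (simp add: hua_e_e) (simp add: hua_apply)

lemma hua_e_Units:
  assumes "z \<in> units"
  shows "hua e z e \<in> Units A"
proof -
  define x where "x = ginv (hua e z) e"
  have x: "hua e z x = e" "x \<in> R"
    using stab_R_iff[OF hua_stab[OF assms], of x] stab_S[OF hua_stab[OF assms]] e_R
    by (auto simp: x_def)
  then have "pmul e x (hua e z e) = e" "pmul e (hua e z e) x = e"
    using hua_pmul[OF assms x(2)] pmul_comm[OF x(2) hua_R[OF assms e_R]] by simp_all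
  then show ?thesis
    using x(2) assms by (auto simp: Units_def hua_R e_R)
qed

end

section \<open>Invertibility of the units and the ideal of non-units\<close>

text \<open>Here \<open>a\<close> and \<open>b\<close> stand for \<open>s\<^sub>y\<close> and \<open>s\<^sub>y\<^sub>+\<^sub>e\<close>, and \<open>t = (-y) \<mu>\<^sub>e\<close> for the inverse of \<open>y\<close>,
  which is not yet known to be one.\<close>

lemma (in cring) double_square_eq:
  assumes "y \<in> carrier R" "t \<in> carrier R" "a \<in> carrier R" "b \<in> carrier R"
    and b: "b = a \<oplus> (y \<oplus> y) \<oplus> \<one>"
    and tb: "t \<otimes> b = t \<oplus> (\<one> \<oplus> \<one>) \<oplus> y"
    and ta: "t \<otimes> a = y"
  shows "y \<otimes> y \<oplus> y \<otimes> y = a \<oplus> a"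
proof -
  \<comment> \<open>Two expansions of \<open>y \<otimes> b\<close> are compared: one through
    \<open>b\<close>, the other through \<open>y = t \<otimes> a\<close> and the value of
    \<open>t \<otimes> b\<close>.\<close>
  have "(y \<oplus> y \<otimes> a) \<oplus> (y \<otimes> y \<oplus> y \<otimes> y) = y \<otimes> b"
    unfolding b using assms(1-4) by algebra
  also have "\<dots> = (t \<otimes> b) \<otimes> a"
    unfolding ta[symmetric] using assms(1-4) by algebra
  also have "\<dots> = t \<otimes> a \<oplus> (a \<oplus> a) \<oplus> y \<otimes> a"
    unfolding tb using assms(1-4) by algebra
  also have "\<dots> = (y \<oplus> y \<otimes> a) \<oplus> (a \<oplus> a)"
    unfolding ta using assms(1-4) by algebra
  finally show ?thesis
    using assms(1-4) by simp
qed

text \<open>The identity (a + 1)^2 = (a - 1)^2 + 4a multiplied by \<open>x\<close>, with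
  \<open>y\<close> in the role of a - 1 so that no subtraction occurs.\<close>

lemma (in cring) square_polarization:
  assumes "y \<in> carrier R" "x \<in> carrier R"
  defines "p \<equiv> x \<otimes> (y \<oplus> \<one>)"
  shows "x \<otimes> ((y \<oplus> \<one> \<oplus> \<one>) \<otimes> (y \<oplus> \<one> \<oplus> \<one>)) = x \<otimes> (y \<otimes> y) \<oplus> ((p \<oplus> p) \<oplus> (p \<oplus> p))"
  unfolding p_def using assms(1,2) by algebra

lemma (in cring) factor_of_square_Units:
  assumes "y \<in> carrier R" "y \<otimes> y \<in> Units R"
  shows "y \<in> Units R"
proof -
  obtain c where c: "c \<in> carrier R" "c \<otimes> (y \<otimes> y) = \<one>"
    using assms(2) by (auto simp: Units_def)
  then have "(c \<otimes> y) \<otimes> y = \<one>"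
    using assms(1) by (simp add: m_assoc)
  moreover have "y \<otimes> (c \<otimes> y) = (c \<otimes> y) \<otimes> y"
    using c(1) assms(1) by (intro m_comm) simp_all
  ultimately show ?thesis
    using c(1) assms(1) by (auto simp: Units_def)
qed

text \<open>A proper ideal contains no invertible element and so lies in \<open>I\<close>.\<close>

lemma (in cring) local_ringI:
  assumes I: "ideal I R" and one: "\<one> \<notin> I" and units: "carrier R - I \<subseteq> Units R"
  shows "local_ring R"
proof -
  have sub: "J \<subseteq> I" if J: "ideal J R" "J \<noteq> carrier R" for J
  proof
    fix x assume x: "x \<in> J"
    interpret J: ideal J R by (rule J(1))
    show "x \<in> I"
    proof (rule ccontr)
      assume "x \<notin> I"
      then have "x \<in> Units R" using x units J.Icarr by blast
      then obtain c where "c \<in> carrier R" "c \<otimes> x = \<one>" by (auto simp: Units_def)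
      then have "\<one> \<in> J" using J.I_l_closed[OF x] by metis
      then show False using J.one_imp_carrier J(2) by blast
    qed
  qed
  have "I \<noteq> carrier R" using one by blast
  have max: "maximalideal I R"
  proof (rule maximalidealI[OF I])
    show "carrier R \<noteq> I" using \<open>I \<noteq> carrier R\<close> by simp
    show "J = I \<or> J = carrier R" if "ideal J R" "I \<subseteq> J" "J \<subseteq> carrier R" for J
      using sub[OF that(1)] that by blast
  qed
  moreover have "J = I" if J: "maximalideal J R" for J
  proof -
    have "ideal J R" "J \<noteq> carrier R"
      using maximalideal.axioms(1)[OF J] maximalideal.I_notcarr[OF J] by auto
    then show ?thesis
      using sub[of J] maximalideal.I_maximal[OF J I] ideal.Icarr[OF I] \<open>I \<noteq> carrier R\<close> by blast
  qed
  ultimately show ?thesis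
    unfolding local_ring_def using is_cring by blast
qed

context special_abelian_local_moufang_set
begin

text \<open>As \<open>\<mu> e\<close> is an involution, \<open>hua e z\<close> sends
  \<open>t\<close> to \<open>\<mu> z (neg y)\<close>. The three equations of
  \<open>double_square_eq\<close> come from \<open>mu_sum\<close> with first summand
  \<open>e\<close>, from \<open>mu_sum\<close> with second summand \<open>e\<close>, and from
  \<open>mu_self\<close>.\<close>

lemma square_eq_hua:
  assumes y: "y \<in> units" and ye: "y \<boxplus> e \<in> units"
  shows "pmul e y y = hua e y e"
proof (rule double_cancel)
  have ey: "e \<boxplus> y \<in> units" using ye y padd_comm e_R units_R by metis
  define t where "t = \<mu> e (neg y)"
  have t: "t \<in> R" using y by (simp add: t_def mu_units_iff neg_units e_units units_R)
  have hua_t: "hua e z t = \<mu> z (neg y)" for z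
    using y by (simp add: t_def hua_apply mu_e_involution neg_R units_R)
  have "hua e (y \<boxplus> e) e = hua e y e \<boxplus> (y \<boxplus> y) \<boxplus> e"
    using mu_sum[OF e_units y ey] padd_comm[OF e_R units_R[OF y]] by (simp add: hua_at_e)
  moreover have "pmul e t (hua e (y \<boxplus> e) e) = t \<boxplus> (e \<boxplus> e) \<boxplus> y"
    using mu_sum[OF y e_units ye, folded t_def] ye t by (simp add: hua_t flip: hua_pmul)
  moreover have "pmul e t (hua e y e) = y"
    using y t by (simp add: hua_t mu_self flip: hua_pmul)
  ultimately show "pmul e y y \<boxplus> pmul e y y = hua e y e \<boxplus> hua e y e"
    using cring.double_square_eq[OF cring_A, of y t "hua e y e" "hua e (y \<boxplus> e) e"] t y ye
    by (simp add: units_R hua_R e_R padd_closed)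
qed (use y in \<open>simp_all add: pmul_R hua_R e_R units_R\<close>)

text \<open>If \<open>y \<boxplus> e\<close> is not a unit, then \<open>neg y \<boxplus> e\<close>
  is one, and \<open>neg y\<close> has the same square as \<open>y\<close>.\<close>

lemma square_hua_ex:
  assumes y: "y \<in> units"
  shows "\<exists>z\<in>units. pmul e y y = hua e z e"
proof (cases "y \<boxplus> e \<in> units")
  case True
  then show ?thesis using square_eq_hua[OF y] y by blast
next
  case False
  have "neg (neg e \<boxplus> y) = neg y \<boxplus> e" using units_R[OF y] e_R by algebra
  then have "neg y \<boxplus> e \<in> units"
    using neg_units[OF neg_e_padd_unit[OF y False]] by simp
  then have "pmul e (neg y) (neg y) = hua e (neg y) e"
    by (rule square_eq_hua[OF neg_units[OF y]])
  moreover have "pmul e (neg y) (neg y) = pmul e y y"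
    using ring.l_minus[OF cring.axioms(1)[OF cring_A], of y "neg y"]
      ring.r_minus[OF cring.axioms(1)[OF cring_A], of y y] units_R[OF y]
    by (simp add: neg_A neg_R pmul_R neg_neg)
  ultimately show ?thesis using neg_units[OF y] by metis
qed

lemma units_Units: "y \<in> units \<Longrightarrow> y \<in> Units A"
  using square_hua_ex[of y] hua_e_Units cring.factor_of_square_Units[OF cring_A, of y]
  by (auto simp: units_R)

text \<open>Multiplication by the square of a unit is a Hua map, and these preserve the units in
  both directions.\<close>

lemma nonunit_pmul_square:
  assumes "x \<in> R - units" "a \<in> units"
  shows "pmul e x (pmul e a a) \<in> R - units"
proof -
  obtain z where z: "z \<in> units" "pmul e a a = hua e z e"
    using square_hua_ex[OF assms(2)] by blast
  then have "pmul e x (pmul e a a) = hua e z x"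
    using hua_pmul[OF z(1)] assms(1) by simp
  then show ?thesis
    using stab_units_iff[OF hua_stab[OF z(1)]] hua_R[OF z(1)] assms(1) by auto
qed

text \<open>When both shifts of \<open>y\<close> by \<open>e\<close> are units, polarization writes
  four times the product as a difference of non-units. Otherwise some shift of \<open>y\<close> is a
  non-unit, and its product with \<open>x\<close> differs from the wanted one only by
  \<open>x\<close>.\<close>

lemma nonunit_pmul:
  assumes x: "x \<in> R - units" and y: "y \<in> R"
  shows "pmul e x y \<in> R - units"
proof -
  have xR: "x \<in> R" using x by simp
  have distr: "pmul e x (a \<boxplus> b) = pmul e x a \<boxplus> pmul e x b" if "a \<in> R" "b \<in> R" for a b
    using that xR pmul_padd[of a b x] by (simp add: pmul_comm[of x] padd_closed)
  have xe: "pmul e x e = x" "pmul e x (neg e) = neg x"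
  proof -
    show xe: "pmul e x e = x" using pmul_comm[OF xR e_R] pmul_e[OF xR] by simp
    then show "pmul e x (neg e) = neg x"
      using ring.r_minus[OF cring.axioms(1)[OF cring_A], of x e] xR by (simp add: neg_A e_R)
  qed
  have main: "pmul e x y \<in> R - units"
    if y: "y \<in> R" and u: "neg e \<boxplus> y \<in> units" "y \<boxplus> e \<in> units" for y
  proof -
    let ?z = "neg e \<boxplus> y" and ?p = "pmul e x y"
    have z: "?z \<boxplus> e = y" using y e_R by algebra
    have p: "?p \<in> R" by (rule pmul_R[OF xR y])
    let ?q = "(?p \<boxplus> ?p) \<boxplus> (?p \<boxplus> ?p)"
    have "pmul e x (pmul e (y \<boxplus> e) (y \<boxplus> e)) = pmul e x (pmul e ?z ?z) \<boxplus> ?q"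
      using cring.square_polarization[OF cring_A, of ?z x] xR u(1) z by (simp add: units_R)
    moreover have "neg (pmul e x (pmul e ?z ?z)) \<boxplus> (pmul e x (pmul e ?z ?z) \<boxplus> ?q) = ?q"
      using p u(1) xR by (intro padd_neg_left) (simp_all add: pmul_R padd_closed units_R)
    ultimately have "?q \<in> R - units"
      using nonunit_padd[OF nonunit_neg[OF nonunit_pmul_square[OF x u(1)]]
          nonunit_pmul_square[OF x u(2)]] by simp
    \<comment> \<open>If \<open>?p\<close> were a unit, (R4) used twice would make \<open>?q\<close>
      a unit.\<close>
    then show ?thesis
      using p double_units[of ?p] double_units[of "?p \<boxplus> ?p"] by blast
  qed
  \<comment> \<open>Both shifts of a non-unit by \<open>e\<close> are units, so \<open>main\<close>
    applies.\<close>
  have I: "pmul e x y \<in> R - units" if "y \<in> R - units" for y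
    using main[of y] that unit_padd_nonunit[OF e_units, of y]
      unit_padd_nonunit[OF neg_units[OF e_units], of y] padd_comm[OF e_R, of y]
    by auto
  consider "neg e \<boxplus> y \<in> units" "y \<boxplus> e \<in> units" | "neg e \<boxplus> y \<notin> units" | "y \<boxplus> e \<notin> units"
    by blast
  then show ?thesis
  proof cases
    case 1
    then show ?thesis using main y by blast
  next
    case 2
    then have "pmul e x (neg e \<boxplus> y) \<boxplus> x \<in> R - units"
      using nonunit_padd[OF I x] y by (simp add: padd_closed neg_R e_R)
    moreover have "pmul e x (neg e \<boxplus> y) \<boxplus> x = pmul e x y"
    proof -
      have "pmul e x (neg e \<boxplus> y) \<boxplus> x = neg x \<boxplus> pmul e x y \<boxplus> x"
        using y xR by (simp add: distr neg_R e_R xe)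
      also have "\<dots> = pmul e x y"
        using xR pmul_R[OF xR y] by algebra
      finally show ?thesis .
    qed
    ultimately show ?thesis by simp
  next
    case 3
    then have "pmul e x (y \<boxplus> e) \<boxplus> neg x \<in> R - units"
      using nonunit_padd[OF I nonunit_neg[OF x]] y by (simp add: padd_closed e_R)
    moreover have "pmul e x (y \<boxplus> e) \<boxplus> neg x = pmul e x y"
    proof -
      have "pmul e x (y \<boxplus> e) \<boxplus> neg x = pmul e x y \<boxplus> x \<boxplus> neg x"
        using y xR by (simp add: distr e_R xe)
      also have "\<dots> = pmul e x y"
        using xR pmul_R[OF xR y] by algebra
      finally show ?thesis .
    qed
    ultimately show ?thesis by simp
  qed
qed

lemma nonunits_ideal: "ideal (R - units) A"
proof (rule idealI)
  show "ring A" using cring_A by (rule cring.axioms)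
  show "subgroup (R - units) (add_monoid A)"
  proof (rule group.subgroupI)
    show "Group.group (add_monoid A)"
      using abelian_group_A by (rule abelian_group.a_group)
    show "R - units \<noteq> {}" using orig_nonunit by blast
    fix a assume a: "a \<in> R - units"
    have "inv\<^bsub>add_monoid A\<^esub> a = neg a"
      using neg_A[of a] a by (simp add: a_inv_def)
    then show "inv\<^bsub>add_monoid A\<^esub> a \<in> R - units" using nonunit_neg[OF a] by simp
    fix b assume "b \<in> R - units"
    then show "a \<otimes>\<^bsub>add_monoid A\<^esub> b \<in> R - units" using nonunit_padd[OF a] by simp
  qed auto
  fix a x assume "a \<in> R - units" "x \<in> carrier A"
  then have a: "a \<in> R - units" "x \<in> R" by simp_all
  then show "a \<otimes>\<^bsub>A\<^esub> x \<in> R - units" using nonunit_pmul by simp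
  then show "x \<otimes>\<^bsub>A\<^esub> a \<in> R - units" using pmul_comm[of x a] a by simp
qed

lemma local_ring_A: "local_ring A"
  using e_units units_Units
  by (intro cring.local_ringI[OF cring_A nonunits_ideal]) auto

end

theorem theorem5p15:
  fixes X :: "'a set" and r :: "('a \<times> 'a) set" and U :: "'a \<Rightarrow> ('a \<Rightarrow> 'a) set"
    and orig infty e :: 'a
  assumes M: "pointed_local_moufang_set X r U orig infty"
    and R1: "pointed_local_moufang_set.special X r U orig infty"
    and R2: "comm_group ((sym_rel X r)\<lparr>carrier := U infty\<rparr>)"
    and R3: "comm_group ((sym_rel X r)
               \<lparr>carrier := pointed_local_moufang_set.hua_subgroup X r U orig infty\<rparr>)"
    and R4: "\<And>x. x \<in> pointed_local_moufang_set.units X r orig infty \<Longrightarrow>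
               pointed_local_moufang_set.twice X r U orig infty x
                 \<in> pointed_local_moufang_set.units X r orig infty"
    and e: "e \<in> pointed_local_moufang_set.units X r orig infty"
  shows "\<exists>u. local_ring (pointed_local_moufang_set.hua_ring X r U orig infty e u) \<and>
             u \<oplus>\<^bsub>pointed_local_moufang_set.hua_ring X r U orig infty e u\<^esub> u
               \<in> Units (pointed_local_moufang_set.hua_ring X r U orig infty e u)"
proof -
  interpret special_abelian_local_moufang_set X r U orig infty e
    using M R1 R2 R3 R4 e
    by (simp add: special_abelian_local_moufang_set_def special_abelian_local_moufang_set_axioms_def)
  \<comment> \<open>The identity is \<open>e\<close>, and two is \<open>e \<boxplus> e\<close>, a
    unit by (R4) and hence invertible.\<close>
  show ?thesis
    using local_ring_A units_Units[OF double_units[OF e_units]] by (intro exI[of _ e]) simp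
qed

end
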